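(* Let $A$ be a digraph algebra, that is, a subalgebra of a full complex matrix algebra $M_n$ which contains a maximal abelian self-adjoint subalgebra of $M_n$. If $I$ is an ideal in $A$, then $I$ is a principal ideal.
   Context: $M_n$ is the algebra of $n\times n$ complex matrices. A digraph algebra is a subalgebra of $M_n$ containing a maximal abelian self-adjoint subalgebra (masa) of $M_n$; up to unitary equivalence it contains the algebra $D_n$ of diagonal matrices. Ideals are two-sided. An ideal $I$ of $A$ is called principal if it is generated, as a two-sided ideal of $A$, by a single element, i.e. there is $g\in A$ such that $I$ is the smallest two-sided ideal of $A$ containing $g$. *)

theory Defs
  imports "HOL-Algebra.Ideal" "Jordan_Normal_Form.Schur_Decomposition"
begin

text \<open>A subalgebra of the algebra of complex \<open>n\<close> by \<open>n\<close> matrices is a complex linear subspace closed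
  under multiplication. Containing the identity is not required here; it is automatic for
  digraph algebras (lemma \<open>one_in_digraph_algebra\<close>).\<close>

definition matrix_subalgebra :: "nat \<Rightarrow> complex mat set \<Rightarrow> bool" where
  "matrix_subalgebra n A \<longleftrightarrow>
     A \<subseteq> carrier_mat n n \<and>
     0\<^sub>m n n \<in> A \<and>
     (\<forall>x\<in>A. \<forall>y\<in>A. x + y \<in> A) \<and>
     (\<forall>c. \<forall>x\<in>A. c \<cdot>\<^sub>m x \<in> A) \<and>
     (\<forall>x\<in>A. \<forall>y\<in>A. x * y \<in> A)"

definition abelian_selfadjoint_subalgebra :: "nat \<Rightarrow> complex mat set \<Rightarrow> bool" where
  "abelian_selfadjoint_subalgebra n D \<longleftrightarrow>
     matrix_subalgebra n D \<and>
     (\<forall>x\<in>D. \<forall>y\<in>D. x * y = y * x) \<and>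
     (\<forall>x\<in>D. mat_adjoint x \<in> D)"

definition masa :: "nat \<Rightarrow> complex mat set \<Rightarrow> bool" where
  "masa n D \<longleftrightarrow>
     abelian_selfadjoint_subalgebra n D \<and>
     (\<forall>E. abelian_selfadjoint_subalgebra n E \<and> D \<subseteq> E \<longrightarrow> E = D)"

definition digraph_algebra :: "nat \<Rightarrow> complex mat set \<Rightarrow> bool" where
  "digraph_algebra n A \<longleftrightarrow> matrix_subalgebra n A \<and> (\<exists>D. masa n D \<and> D \<subseteq> A)"

text \<open>The operations of the ambient matrix ring, restricted to \<open>A\<close>.\<close>

definition subalgebra_ring :: "nat \<Rightarrow> complex mat set \<Rightarrow> complex mat ring" where
  "subalgebra_ring n A = (ring_mat TYPE(complex) n ())\<lparr>carrier := A\<rparr>"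

lemma mat_adjoint_index:
  fixes x :: "complex mat"
  assumes "x \<in> carrier_mat n n" "i < n" "j < n"
  shows "mat_adjoint x $$ (i, j) = cnj (x $$ (j, i))"
  using assms by (auto simp: mat_adjoint_def mat_of_rows_def)

lemma mat_adjoint_carrier:
  fixes x :: "complex mat"
  assumes "x \<in> carrier_mat n n"
  shows "mat_adjoint x \<in> carrier_mat n n"
  using assms by (auto simp: mat_adjoint_def mat_of_rows_def)

lemma one_in_masa:
  assumes "masa n D"
  shows "1\<^sub>m n \<in> D"
proof -
  have sub: "D \<subseteq> carrier_mat n n" and z: "0\<^sub>m n n \<in> D"
    and ad: "\<And>x y. x \<in> D \<Longrightarrow> y \<in> D \<Longrightarrow> x + y \<in> D"
    and sm: "\<And>c x. x \<in> D \<Longrightarrow> c \<cdot>\<^sub>m x \<in> D"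
    and mu: "\<And>x y. x \<in> D \<Longrightarrow> y \<in> D \<Longrightarrow> x * y \<in> D"
    and co: "\<And>x y. x \<in> D \<Longrightarrow> y \<in> D \<Longrightarrow> x * y = y * x"
    and sa: "\<And>x. x \<in> D \<Longrightarrow> mat_adjoint x \<in> D"
    and mx: "\<And>E. abelian_selfadjoint_subalgebra n E \<Longrightarrow> D \<subseteq> E \<Longrightarrow> E = D"
    using assms unfolding masa_def abelian_selfadjoint_subalgebra_def matrix_subalgebra_def
    by blast+
  define E where "E = {d + c \<cdot>\<^sub>m 1\<^sub>m n | d c. d \<in> D}"
  have EI: "x \<in> E" if "d \<in> D" "x = d + c \<cdot>\<^sub>m 1\<^sub>m n" for x d c
    using that by (auto simp: E_def)
  have prod: "(d + c \<cdot>\<^sub>m 1\<^sub>m n) * (e + b \<cdot>\<^sub>m 1\<^sub>m n) = (d * e + (b \<cdot>\<^sub>m d + c \<cdot>\<^sub>m e)) + (c * b) \<cdot>\<^sub>m 1\<^sub>m n"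
    if "d \<in> D" "e \<in> D" for d e :: "complex mat" and c b
  proof -
    have [simp]: "d \<in> carrier_mat n n" "e \<in> carrier_mat n n" using that sub by auto
    have 1: "d * (b \<cdot>\<^sub>m 1\<^sub>m n) = b \<cdot>\<^sub>m d"
      using mult_smult_distrib[of d n n "1\<^sub>m n" n b] right_mult_one_mat[of d n n] by simp
    have 2: "(c \<cdot>\<^sub>m 1\<^sub>m n) * x = c \<cdot>\<^sub>m x" if "x \<in> carrier_mat n n" for x
      using that mult_smult_assoc_mat[of "1\<^sub>m n" n n x n c] left_mult_one_mat[of x n n] by simp
    have "(d + c \<cdot>\<^sub>m 1\<^sub>m n) * (e + b \<cdot>\<^sub>m 1\<^sub>m n)
        = d * (e + b \<cdot>\<^sub>m 1\<^sub>m n) + (c \<cdot>\<^sub>m 1\<^sub>m n) * (e + b \<cdot>\<^sub>m 1\<^sub>m n)"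
      by (rule add_mult_distrib_mat[of _ n n]) auto
    also have "\<dots> = (d * e + d * (b \<cdot>\<^sub>m 1\<^sub>m n)) + c \<cdot>\<^sub>m (e + b \<cdot>\<^sub>m 1\<^sub>m n)"
      by (subst mult_add_distrib_mat[of _ n n _ n]) (auto simp: 2)
    also have "\<dots> = (d * e + (b \<cdot>\<^sub>m d + c \<cdot>\<^sub>m e)) + (c * b) \<cdot>\<^sub>m 1\<^sub>m n"
      unfolding 1
    proof (rule eq_matI, goal_cases)
      case (1 i j)
      then have "i < n" "j < n" by auto
      moreover have "dim_row d = n" "dim_col d = n" "dim_row e = n" "dim_col e = n"
        using \<open>d \<in> carrier_mat n n\<close> \<open>e \<in> carrier_mat n n\<close> by blast+
      ultimately show ?case by (simp add: algebra_simps)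
    next
      case 2
      show ?case using \<open>d \<in> carrier_mat n n\<close> by auto
    next
      case 3
      show ?case using \<open>e \<in> carrier_mat n n\<close> by auto
    qed
    finally show ?thesis .
  qed
  have "matrix_subalgebra n E"
    unfolding matrix_subalgebra_def
  proof (intro conjI ballI allI)
    show "E \<subseteq> carrier_mat n n" using sub by (auto simp: E_def)
    show "0\<^sub>m n n \<in> E" by (rule EI[OF z, of _ 0]) auto
  next
    fix x y assume "x \<in> E" "y \<in> E"
    then obtain d c e b where *: "d \<in> D" "e \<in> D" "x = d + c \<cdot>\<^sub>m 1\<^sub>m n" "y = e + b \<cdot>\<^sub>m 1\<^sub>m n"
      by (auto simp: E_def)
    have [simp]: "d \<in> carrier_mat n n" "e \<in> carrier_mat n n" using * sub by auto
    have "x + y = (d + e) + (c + b) \<cdot>\<^sub>m 1\<^sub>m n"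
      unfolding *(3,4)
      using carrier_matD[OF \<open>d \<in> carrier_mat n n\<close>] carrier_matD[OF \<open>e \<in> carrier_mat n n\<close>]
      by (intro eq_matI) (auto simp: algebra_simps)
    then show "x + y \<in> E" by (rule EI[OF ad[OF *(1,2)]])
    show "x * y \<in> E"
      unfolding * prod[OF *(1,2)] by (rule EI[OF ad[OF mu[OF *(1,2)] ad[OF sm[OF *(1)] sm[OF *(2)]]]]) simp
  next
    fix a x assume "x \<in> E"
    then obtain d c where *: "d \<in> D" "x = d + c \<cdot>\<^sub>m 1\<^sub>m n" by (auto simp: E_def)
    have "a \<cdot>\<^sub>m x = a \<cdot>\<^sub>m d + (a * c) \<cdot>\<^sub>m 1\<^sub>m n"
      unfolding *(2) using carrier_matD[of d n n] *(1) sub by (intro eq_matI) (auto simp: algebra_simps)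
    then show "a \<cdot>\<^sub>m x \<in> E" by (rule EI[OF sm[OF *(1)]])
  qed
  moreover have "x * y = y * x" if "x \<in> E" "y \<in> E" for x y
  proof -
    obtain d c e b where *: "d \<in> D" "e \<in> D" "x = d + c \<cdot>\<^sub>m 1\<^sub>m n" "y = e + b \<cdot>\<^sub>m 1\<^sub>m n"
      using \<open>x \<in> E\<close> \<open>y \<in> E\<close> by (auto simp: E_def)
    have "d \<in> carrier_mat n n" "e \<in> carrier_mat n n" using * sub by auto
    then have "b \<cdot>\<^sub>m d + c \<cdot>\<^sub>m e = c \<cdot>\<^sub>m e + b \<cdot>\<^sub>m d"
      by (intro comm_add_mat[of _ n n]) auto
    then show ?thesis
      unfolding *(3,4) prod[OF *(1,2)] prod[OF *(2,1)] co[OF *(1,2)] by (simp add: mult.commute)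
  qed
  moreover have "mat_adjoint x \<in> E" if "x \<in> E" for x
  proof -
    obtain d c where *: "d \<in> D" "x = d + c \<cdot>\<^sub>m 1\<^sub>m n" using \<open>x \<in> E\<close> by (auto simp: E_def)
    have d: "d \<in> carrier_mat n n" and x: "x \<in> carrier_mat n n" using * sub by auto
    have "mat_adjoint x = mat_adjoint d + cnj c \<cdot>\<^sub>m 1\<^sub>m n" (is "_ = ?r")
    proof (rule eq_matI)
      have r: "?r \<in> carrier_mat n n" using mat_adjoint_carrier[OF d] by auto
      show "dim_row (mat_adjoint x) = dim_row ?r" "dim_col (mat_adjoint x) = dim_col ?r"
        using carrier_matD[OF mat_adjoint_carrier[OF x]] carrier_matD[OF r] by simp_all
      fix i j assume "i < dim_row ?r" "j < dim_col ?r"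
      then have ij: "i < n" "j < n" using carrier_matD[OF r] by simp_all
      show "mat_adjoint x $$ (i, j) = ?r $$ (i, j)"
        using mat_adjoint_index[OF d ij] mat_adjoint_index[OF x ij] ij
          carrier_matD[OF mat_adjoint_carrier[OF d]] carrier_matD[OF d]
        by (simp add: *(2))
    qed
    then show ?thesis by (rule EI[OF sa[OF *(1)]])
  qed
  ultimately have "abelian_selfadjoint_subalgebra n E"
    unfolding abelian_selfadjoint_subalgebra_def by blast
  moreover have "D \<subseteq> E"
  proof
    fix d assume "d \<in> D"
    moreover from this sub have "d = d + 0 \<cdot>\<^sub>m 1\<^sub>m n"
      using carrier_matD[of d n n] by (intro eq_matI) auto
    ultimately show "d \<in> E" by (rule EI)
  qed
  ultimately have "E = D" by (rule mx)
  moreover have "1\<^sub>m n \<in> E" by (rule EI[OF z, of _ 1]) auto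
  ultimately show ?thesis by simp
qed

lemma one_in_digraph_algebra:
  assumes "digraph_algebra n A"
  shows "1\<^sub>m n \<in> A"
  using assms one_in_masa by (auto simp: digraph_algebra_def)

text \<open>Hence \<open>subalgebra_ring n A\<close> is a ring in the (unital) sense of HOL-Algebra, and its ideals
  are automatically closed under complex scalars, so they are exactly the algebra ideals of \<open>A\<close>.\<close>

lemma ring_digraph_algebra:
  assumes "digraph_algebra n A"
  shows "ring (subalgebra_ring n A)"
proof -
  have sub: "A \<subseteq> carrier_mat n n" and z: "0\<^sub>m n n \<in> A"
    and ad: "\<And>x y. x \<in> A \<Longrightarrow> y \<in> A \<Longrightarrow> x + y \<in> A"
    and sm: "\<And>c x. x \<in> A \<Longrightarrow> c \<cdot>\<^sub>m x \<in> A"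
    and mu: "\<And>x y. x \<in> A \<Longrightarrow> y \<in> A \<Longrightarrow> x * y \<in> A"
    using assms unfolding digraph_algebra_def matrix_subalgebra_def by blast+
  have c: "x \<in> carrier_mat n n" if "x \<in> A" for x using that sub by blast
  show ?thesis
  proof (rule ringI)
    show "abelian_group (subalgebra_ring n A)"
    proof (rule abelian_groupI)
      fix x assume "x \<in> carrier (subalgebra_ring n A)"
      then have x: "x \<in> A" by (simp add: subalgebra_ring_def)
      have "(-1) \<cdot>\<^sub>m x + x = 0\<^sub>m n n"
        using carrier_matD[OF c[OF x]] by (intro eq_matI) auto
      then show "\<exists>y\<in>carrier (subalgebra_ring n A).
          y \<oplus>\<^bsub>subalgebra_ring n A\<^esub> x = \<zero>\<^bsub>subalgebra_ring n A\<^esub>"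
        using sm[OF x] by (auto simp: subalgebra_ring_def ring_mat_def intro!: bexI[of _ "(-1) \<cdot>\<^sub>m x"])
    qed (auto simp: subalgebra_ring_def ring_mat_def z
        intro: ad left_add_zero_mat[OF c] comm_add_mat[OF c c] assoc_add_mat[OF c c c])
    show "monoid (subalgebra_ring n A)"
      by (rule monoidI) (auto simp: subalgebra_ring_def ring_mat_def one_in_digraph_algebra[OF assms]
          intro: mu left_mult_one_mat[OF c] right_mult_one_mat[OF c] assoc_mult_mat[OF c c c])
  qed (auto simp: subalgebra_ring_def ring_mat_def
      intro: add_mult_distrib_mat[OF c c c] mult_add_distrib_mat[OF c c c])
qed

end

theory Submission
  imports Defs "Jordan_Normal_Form.Spectral_Radius"
begin

text \<open>Why ideals of a digraph algebra \<open>A\<close> are principal. Up to unitary conjugation \<open>A\<close> contains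
  all diagonal matrices. Multiplying an ideal on both sides by diagonal matrix units then extracts
  single entries: if some element of the ideal has a nonzero entry at \<open>(i, j)\<close>, the ideal contains
  the matrix unit at \<open>(i, j)\<close>. Hence an ideal consists of all matrices supported on its
  pattern, the set of positions at which some element is nonzero
  (\<open>diagonal_bimodule_pattern\<close>). The matrix with entry 1 on the pattern and 0 elsewhere lies in
  the ideal and already has the full pattern, so the ideal that it generates is the whole ideal.

  The analytic ingredient is that a masa is unitarily conjugate to the diagonal algebra
  (\<open>masa_is_unitarily_diagonal\<close>). It is deduced from the spectral theorem for a single
  normal matrix as follows. Choose a Hermitian \<open>h\<close> in the masa with as many distinct
  eigenvalues as possible. For another Hermitian \<open>y\<close> in the masa, the matrix
  \<open>h + \<i> y\<close> is normal, and diagonalising it diagonalises \<open>h\<close> and \<open>y\<close> simultaneously. If \<open>y\<close>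
  took two values on one eigenspace of \<open>h\<close>, then \<open>h + \<epsilon> y\<close> would, for a generic
  real \<open>\<epsilon>\<close>, have more eigenvalues than \<open>h\<close>. So \<open>y\<close> is a function of \<open>h\<close>, and every basis that
  diagonalises \<open>h\<close> diagonalises \<open>y\<close>. The masa is therefore contained in a conjugate of
  the diagonal algebra, and equals it by maximality.\<close>

section \<open>Adjoints and diagonal matrices\<close>

lemma mat_adjoint_eqI:
  fixes x y :: "complex mat"
  assumes "x \<in> carrier_mat n n" "y \<in> carrier_mat n n"
    and "\<And>i j. i < n \<Longrightarrow> j < n \<Longrightarrow> y $$ (i, j) = cnj (x $$ (j, i))"
  shows "mat_adjoint x = y"
  using assms carrier_matD[OF mat_adjoint_carrier[OF assms(1)]]
  by (intro eq_matI) (simp_all add: mat_adjoint_index[OF assms(1)])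

lemma mat_adjoint_add:
  fixes x y :: "complex mat"
  assumes "x \<in> carrier_mat n n" "y \<in> carrier_mat n n"
  shows "mat_adjoint (x + y) = mat_adjoint x + mat_adjoint y"
  using assms carrier_matD[OF mat_adjoint_carrier[OF assms(1)]] carrier_matD[OF mat_adjoint_carrier[OF assms(2)]]
  by (intro mat_adjoint_eqI[of _ n]) (simp_all add: mat_adjoint_carrier mat_adjoint_index)

lemma mat_adjoint_smult:
  fixes x :: "complex mat"
  assumes "x \<in> carrier_mat n n"
  shows "mat_adjoint (c \<cdot>\<^sub>m x) = cnj c \<cdot>\<^sub>m mat_adjoint x"
  using assms carrier_matD[OF mat_adjoint_carrier[OF assms(1)]]
  by (intro mat_adjoint_eqI[of _ n]) (simp_all add: mat_adjoint_carrier mat_adjoint_index)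

lemma mat_adjoint_mult:
  fixes x y :: "complex mat"
  assumes "x \<in> carrier_mat n n" "y \<in> carrier_mat n n"
  shows "mat_adjoint (x * y) = mat_adjoint y * mat_adjoint x"
  using assms carrier_matD[OF mat_adjoint_carrier[OF assms(1)]] carrier_matD[OF mat_adjoint_carrier[OF assms(2)]]
  by (intro mat_adjoint_eqI[of _ n])
    (simp_all add: mult_carrier_mat[of _ n n] mat_adjoint_carrier mat_adjoint_index scalar_prod_def mult.commute)

lemma mat_adjoint_adjoint:
  fixes x :: "complex mat"
  assumes "x \<in> carrier_mat n n"
  shows "mat_adjoint (mat_adjoint x) = x"
  using assms by (intro mat_adjoint_eqI[of _ n]) (simp_all add: mat_adjoint_carrier mat_adjoint_index)

lemma mat_adjoint_diag:
  "mat_adjoint (mat_diag n a) = mat_diag n (\<lambda>i. cnj (a i))"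
  by (intro mat_adjoint_eqI[of _ n]) (auto simp: mat_diag_def)

lemma mat_diag_add:
  "mat_diag n a + mat_diag n b = mat_diag n (\<lambda>i. a i + (b i :: complex))"
  by (intro eq_matI) (auto simp: mat_diag_def)

lemma mat_diag_smult:
  "c \<cdot>\<^sub>m mat_diag n a = mat_diag n (\<lambda>i. c * (a i :: complex))"
  by (intro eq_matI) (auto simp: mat_diag_def)

section \<open>Unitary conjugation\<close>

definition unitary_mat :: "nat \<Rightarrow> complex mat \<Rightarrow> bool" where
  "unitary_mat n U \<longleftrightarrow> U \<in> carrier_mat n n \<and> mat_adjoint U * U = 1\<^sub>m n"

definition unitary_conj :: "complex mat \<Rightarrow> complex mat \<Rightarrow> complex mat" where
  "unitary_conj U x = U * x * mat_adjoint U"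

context
  fixes n :: nat
begin

text \<open>Fixing the intermediate dimensions turns the general rules
  into rewrite rules whose side conditions contain no unknowns, so that the simplifier can
  discharge them.\<close>

lemmas square_mat =
  mult_carrier_mat[of _ n n _ n] mat_adjoint_carrier[of _ n] assoc_mult_mat[of _ n n _ n _ n]
  mat_adjoint_mult[of _ n] mat_adjoint_adjoint[of _ n]

lemma unitary_matD:
  assumes "unitary_mat n U"
  shows "U \<in> carrier_mat n n" "mat_adjoint U \<in> carrier_mat n n"
    "mat_adjoint U * U = 1\<^sub>m n" "U * mat_adjoint U = 1\<^sub>m n"
  using assms mat_mult_left_right_inverse[of "mat_adjoint U" n U] mat_adjoint_carrier[of U n]
  by (auto simp: unitary_mat_def)

lemma unitary_mat_adjoint:
  assumes "unitary_mat n U"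
  shows "unitary_mat n (mat_adjoint U)"
  using unitary_matD[OF assms] unfolding unitary_mat_def by (simp add: mat_adjoint_adjoint[of U n])

lemma unitary_cancel:
  assumes "unitary_mat n U" "x \<in> carrier_mat n n"
  shows "mat_adjoint U * (U * x) = x" "U * (mat_adjoint U * x) = x"
  using unitary_matD[OF assms(1)] assms(2)
    assoc_mult_mat[of U n n "mat_adjoint U" n x n] assoc_mult_mat[of "mat_adjoint U" n n U n x n]
  by (metis left_mult_one_mat)+

lemma unitary_mat_mult:
  assumes "unitary_mat n U" "unitary_mat n V"
  shows "unitary_mat n (U * V)"
  using unitary_matD[OF assms(1)] unitary_matD[OF assms(2)] unitary_cancel[OF assms(1)]
  unfolding unitary_mat_def by (simp add: square_mat)

lemma unitary_conj_carrier:
  assumes "unitary_mat n U" "x \<in> carrier_mat n n"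
  shows "unitary_conj U x \<in> carrier_mat n n"
  using assms(2) unitary_matD(1,2)[OF assms(1)] unfolding unitary_conj_def by (simp add: square_mat)

lemma unitary_conj_comp:
  assumes "unitary_mat n U" "unitary_mat n V" "x \<in> carrier_mat n n"
  shows "unitary_conj U (unitary_conj V x) = unitary_conj (U * V) x"
  using assms(3) unitary_matD(1,2)[OF assms(1)] unitary_matD(1,2)[OF assms(2)]
  unfolding unitary_conj_def by (simp add: square_mat)

lemma unitary_conj_inverse:
  assumes "unitary_mat n U" "x \<in> carrier_mat n n"
  shows "unitary_conj (mat_adjoint U) (unitary_conj U x) = x"
    "unitary_conj U (unitary_conj (mat_adjoint U) x) = x"
  using assms(2) unitary_matD[OF assms(1)] unitary_cancel[OF assms(1)]
  unfolding unitary_conj_def by (simp_all add: square_mat)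

lemma unitary_conj_mult:
  assumes "unitary_mat n U" "x \<in> carrier_mat n n" "y \<in> carrier_mat n n"
  shows "unitary_conj U (x * y) = unitary_conj U x * unitary_conj U y"
  using assms(2,3) unitary_matD(1,2)[OF assms(1)] unitary_cancel[OF assms(1)]
  unfolding unitary_conj_def by (simp add: square_mat)

lemma unitary_conj_add:
  assumes "unitary_mat n U" "x \<in> carrier_mat n n" "y \<in> carrier_mat n n"
  shows "unitary_conj U (x + y) = unitary_conj U x + unitary_conj U y"
  using assms(2,3) unitary_matD(1,2)[OF assms(1)] unfolding unitary_conj_def
  by (simp add: mult_add_distrib_mat[of _ n n _ n] add_mult_distrib_mat[of _ n n _ _ n] square_mat)

lemma unitary_conj_smult:
  assumes "unitary_mat n U" "x \<in> carrier_mat n n"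
  shows "unitary_conj U (c \<cdot>\<^sub>m x) = c \<cdot>\<^sub>m unitary_conj U x"
  using assms(2) unitary_matD(1,2)[OF assms(1)] unfolding unitary_conj_def
  by (simp add: mult_smult_distrib[of _ n n _ n] mult_smult_assoc_mat[of _ n n _ n] square_mat)

lemma unitary_conj_adjoint:
  assumes "unitary_mat n U" "x \<in> carrier_mat n n"
  shows "mat_adjoint (unitary_conj U x) = unitary_conj U (mat_adjoint x)"
  using assms(2) unitary_matD(1,2)[OF assms(1)] unfolding unitary_conj_def by (simp add: square_mat)

end

section \<open>The spectral theorem for normal matrices\<close>

text \<open>The block diagonal matrix with blocks \<open>c\<close> and \<open>M\<close>. It drives the induction on the size
  in the spectral theorem; the explicit entries shift the indices of \<open>M\<close> by one.\<close>

definition corner_ext :: "complex \<Rightarrow> complex mat \<Rightarrow> complex mat" where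
  "corner_ext c M = mat (Suc (dim_row M)) (Suc (dim_col M))
     (\<lambda>(i, j). if i = 0 \<and> j = 0 then c else if i = 0 \<or> j = 0 then 0 else M $$ (i - 1, j - 1))"

lemma corner_ext_carrier:
  "M \<in> carrier_mat n n \<Longrightarrow> corner_ext c M \<in> carrier_mat (Suc n) (Suc n)"
  by (rule carrier_matI) (simp_all add: corner_ext_def)

lemma corner_ext_index:
  assumes "M \<in> carrier_mat n n"
  shows "corner_ext c M $$ (0, 0) = c"
    "i < n \<Longrightarrow> corner_ext c M $$ (Suc i, 0) = 0"
    "j < n \<Longrightarrow> corner_ext c M $$ (0, Suc j) = 0"
    "i < n \<Longrightarrow> j < n \<Longrightarrow> corner_ext c M $$ (Suc i, Suc j) = M $$ (i, j)"
  using carrier_matD[OF assms] by (simp_all add: corner_ext_def)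

lemma corner_ext_eqI:
  assumes "M \<in> carrier_mat n n" "X \<in> carrier_mat (Suc n) (Suc n)" "X $$ (0, 0) = c"
    and "\<And>i. i < n \<Longrightarrow> X $$ (Suc i, 0) = 0" "\<And>j. j < n \<Longrightarrow> X $$ (0, Suc j) = 0"
    and "\<And>i j. i < n \<Longrightarrow> j < n \<Longrightarrow> X $$ (Suc i, Suc j) = M $$ (i, j)"
  shows "X = corner_ext c M"
proof (rule eq_matI)
  note E = carrier_matD[OF corner_ext_carrier[OF assms(1), of c]]
  fix i j assume "i < dim_row (corner_ext c M)" "j < dim_col (corner_ext c M)"
  then show "X $$ (i, j) = corner_ext c M $$ (i, j)"
    using assms(3-) by (cases i; cases j) (simp_all add: E corner_ext_index[OF assms(1)])
qed (use assms(1,2) in \<open>simp_all add: corner_ext_def\<close>)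

lemma corner_ext_mult:
  assumes "M \<in> carrier_mat n n" "K \<in> carrier_mat n n"
  shows "corner_ext c M * corner_ext d K = corner_ext (c * d) (M * K)"
proof -
  note E = corner_ext_carrier[OF assms(1), of c] corner_ext_carrier[OF assms(2), of d]
  have *: "(corner_ext c M * corner_ext d K) $$ (i, j) =
      corner_ext c M $$ (i, 0) * corner_ext d K $$ (0, j)
      + (\<Sum>k<n. corner_ext c M $$ (i, Suc k) * corner_ext d K $$ (Suc k, j))"
    if "i < Suc n" "j < Suc n" for i j
    using that carrier_matD[OF E(1)] carrier_matD[OF E(2)]
    by (simp add: scalar_prod_def atLeast0LessThan sum.lessThan_Suc_shift del: sum.lessThan_Suc)
  have "(corner_ext c M * corner_ext d K) $$ (Suc i, Suc j) = (M * K) $$ (i, j)"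
    if "i < n" "j < n" for i j
    using that carrier_matD[OF assms(1)] carrier_matD[OF assms(2)]
    by (simp add: * corner_ext_index[OF assms(1)] corner_ext_index[OF assms(2)]
        scalar_prod_def atLeast0LessThan)
  with mult_carrier_mat[OF assms] mult_carrier_mat[OF E] show ?thesis
    by (intro corner_ext_eqI[of _ n])
      (simp_all add: * corner_ext_index[OF assms(1)] corner_ext_index[OF assms(2)])
qed

lemma corner_ext_adjoint:
  assumes "M \<in> carrier_mat n n"
  shows "mat_adjoint (corner_ext c M) = corner_ext (cnj c) (mat_adjoint M)"
  by (rule corner_ext_eqI[of _ n])
    (simp_all add: mat_adjoint_carrier corner_ext_carrier assms corner_ext_index[OF assms]
      mat_adjoint_index[OF assms] mat_adjoint_index[OF corner_ext_carrier[OF assms]])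

lemma corner_ext_inject:
  assumes "M \<in> carrier_mat n n" "K \<in> carrier_mat n n" "corner_ext c M = corner_ext d K"
  shows "M = K"
proof (rule eq_matI)
  fix i j assume "i < dim_row K" "j < dim_col K"
  then show "M $$ (i, j) = K $$ (i, j)"
    using assms corner_ext_index(4)[of _ n i j] by (metis carrier_matD)
qed (use assms in auto)

lemma corner_ext_diag:
  "corner_ext c (mat_diag n a) = mat_diag (Suc n) (case_nat c a)"
  by (rule corner_ext_eqI[of _ n, symmetric]) (simp_all add: mat_diag_def)

lemma unitary_corner_ext:
  assumes "unitary_mat n U"
  shows "unitary_mat (Suc n) (corner_ext 1 U)"
proof -
  note U = unitary_matD[OF assms]
  have "1\<^sub>m (Suc n) = corner_ext 1 (1\<^sub>m n)"
    by (rule corner_ext_eqI[of _ n]) simp_all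
  then show ?thesis
    unfolding unitary_mat_def
    by (simp add: U corner_ext_carrier[OF U(1)] corner_ext_adjoint[OF U(1)] corner_ext_mult[OF U(2,1)])
qed

text \<open>Gram-Schmidt applied to a basis beginning with \<open>v\<close> gives orthogonal columns; dividing each by
  its norm makes the matrix unitary.\<close>

lemma unitary_first_column:
  fixes v :: "complex vec"
  assumes v: "v \<in> carrier_vec n" and v0: "v \<noteq> 0\<^sub>v n"
  obtains U c where "unitary_mat n U" "col U 0 = c \<cdot>\<^sub>v v"
proof -
  interpret cof_vec_space n "TYPE(complex)" .
  define bs where "bs = basis_completion v"
  note bc = basis_completion[OF v v0, folded bs_def]
  define ws where "ws = gram_schmidt n bs"
  have "corthogonal ws" "set ws \<subseteq> carrier_vec n" "length ws = n"
    using gram_schmidt_result[OF bc(2) bc(4) bc(5) ws_def] bc(6) by auto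
  have n0: "n > 0" using v v0 by (cases n) auto
  have hd: "hd ws = v"
    using gram_schmidt_hd[of v "tl bs"] v bc(6,7) n0
    by (cases bs) (auto simp: ws_def)
  define W where "W = mat_of_cols n ws"
  have W: "W \<in> carrier_mat n n" using \<open>length ws = n\<close> by (auto simp: W_def)
  have col0: "col W 0 = v"
    using hd n0 \<open>length ws = n\<close> v by (cases ws) (auto simp: W_def col_mat_of_cols)
  have orth: "corthogonal_mat W"
    unfolding W_def by (rule orthogonal_mat_of_cols) fact+
  define B where "B = mat_adjoint W * W"
  note W' = mat_adjoint_carrier[OF W]
  have B: "B $$ (i, j) = (\<Sum>k<n. cnj (W $$ (k, i)) * W $$ (k, j))" if "i < n" "j < n" for i j
    using that W W' by (simp add: B_def scalar_prod_def mat_adjoint_index[OF W] atLeast0LessThan)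
  define r where "r i = sqrt (\<Sum>k<n. (cmod (W $$ (k, i)))\<^sup>2)" for i
  have Bii: "B $$ (i, i) = of_real ((r i)\<^sup>2)" if "i < n" for i
    using that by (simp add: B r_def sum_nonneg mult.commute flip: complex_norm_square)
  have Bij: "B $$ (i, j) = 0" if "i < n" "j < n" "i \<noteq> j" for i j
    using orth that W W' unfolding corthogonal_mat_def Let_def diagonal_mat_def
    by (simp add: B_def)
  have r0: "r i \<noteq> 0" if "i < n" for i
    using orth that W Bii[OF that] unfolding corthogonal_mat_def Let_def B_def by auto
  define U where "U = W * mat_diag n (\<lambda>i. of_real (1 / r i))"
  have U: "U \<in> carrier_mat n n" using W by (simp add: U_def mult_carrier_mat[of _ n n])
  have "mat_adjoint U * U = mat_diag n (\<lambda>i. of_real (1 / r i)) * B * mat_diag n (\<lambda>i. of_real (1 / r i))"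
    using W W' by (simp add: U_def B_def mat_adjoint_mult[of _ n] mat_adjoint_diag assoc_mult_mat[of _ n n _ n _ n])
  also have "\<dots> = 1\<^sub>m n"
    using W W' r0
    by (subst mat_diag_mult_left[of B n n], simp add: B_def, subst mat_diag_mult_right[of _ n n], simp)
      (intro eq_matI, auto simp: Bii Bij power2_eq_square)
  finally have "unitary_mat n U" using U by (simp add: unitary_mat_def)
  moreover have "col U 0 = of_real (1 / r 0) \<cdot>\<^sub>v v"
    unfolding col0[symmetric] U_def using W n0
    by (subst mat_diag_mult_right[of _ n n]) (auto intro!: eq_vecI)
  ultimately show ?thesis by (rule that)
qed

text \<open>A unitary whose first column is an eigenvector clears the first column below the diagonal.
  For a normal matrix the first row and the first column have the same norm, so the rest of the
  first row vanishes as well. What remains is a normal block of smaller size.\<close>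

theorem spectral_theorem_normal:
  fixes N :: "complex mat"
  assumes "N \<in> carrier_mat n n" "N * mat_adjoint N = mat_adjoint N * N"
  shows "\<exists>U a. unitary_mat n U \<and> N = unitary_conj U (mat_diag n a)"
  using assms
proof (induction n arbitrary: N)
  case 0
  have U: "unitary_mat 0 (1\<^sub>m 0)"
    using mat_adjoint_carrier[of "1\<^sub>m 0" 0] by (auto simp: unitary_mat_def intro!: eq_matI)
  have "N = unitary_conj (1\<^sub>m 0) (mat_diag 0 (\<lambda>_. 0))"
    using 0(1) carrier_matD[OF unitary_conj_carrier[OF U mat_diag_dim]] by (intro eq_matI) auto
  with U show ?case by blast
next
  case (Suc n)
  note N = Suc.prems(1)
  obtain \<mu> where "eigenvalue N \<mu>"
    using spectrum_non_empty[OF N] by (auto simp: spectrum_def)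
  then obtain v where v: "v \<in> carrier_vec (Suc n)" "v \<noteq> 0\<^sub>v (Suc n)" "N *\<^sub>v v = \<mu> \<cdot>\<^sub>v v"
    using N by (auto simp: eigenvalue_def eigenvector_def)
  obtain U c where U: "unitary_mat (Suc n) U" "col U 0 = c \<cdot>\<^sub>v v"
    using unitary_first_column[OF v(1,2)] by metis
  note UD = unitary_matD[OF U(1)] and U' = unitary_mat_adjoint[OF U(1)]
  define T where "T = unitary_conj (mat_adjoint U) N"
  have T: "T \<in> carrier_mat (Suc n) (Suc n)" 
    unfolding T_def by (rule unitary_conj_carrier[OF U' N])
  note T' = mat_adjoint_carrier[OF T]
  have NT: "N = unitary_conj U T"
    unfolding T_def using unitary_conj_inverse(2)[OF U(1) N] by simp
  have Tnormal: "T * mat_adjoint T = mat_adjoint T * T"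
    using Suc.prems(2) mat_adjoint_carrier[OF N] N
    by (simp add: T_def unitary_conj_adjoint[OF U' N] flip: unitary_conj_mult[OF U'])
  have ev: "N *\<^sub>v col U 0 = \<mu> \<cdot>\<^sub>v col U 0"
    unfolding U(2) using v N by (simp add: mult_mat_vec[of _ "Suc n" "Suc n"] smult_smult_assoc mult.commute)
  have "col T 0 = \<mu> \<cdot>\<^sub>v col (mat_adjoint U * U) 0"
  proof -
    have "T = mat_adjoint U * (N * U)"
      using UD N by (simp add: T_def unitary_conj_def mat_adjoint_adjoint assoc_mult_mat[of _ "Suc n" "Suc n" _ "Suc n" _ "Suc n"])
    then have "col T 0 = mat_adjoint U *\<^sub>v (N *\<^sub>v col U 0)"
      using col_mult2[OF UD(2) mult_carrier_mat[OF N UD(1)]] col_mult2[OF N UD(1)] by simp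
    also have "\<dots> = \<mu> \<cdot>\<^sub>v (mat_adjoint U *\<^sub>v col U 0)"
      unfolding ev by (rule mult_mat_vec[OF UD(2) col_carrier_vec[OF _ UD(1)]]) simp
    finally show ?thesis using col_mult2[OF UD(2,1)] by simp
  qed
  then have "col T 0 $ i = (\<mu> \<cdot>\<^sub>v col (1\<^sub>m (Suc n)) 0) $ i" for i
    by (simp add: UD)
  then have col0: "T $$ (i, 0) = (if i = 0 then \<mu> else 0)" if "i < Suc n" for i
    using that T by (metis (no_types, lifting) col_one index_col index_one_mat(2,3) index_smult_vec(1) index_unit_vec(1,3) carrier_matD mult.right_neutral mult_zero_right zero_less_Suc)
  \<comment> \<open>The entries at \<open>(0, 0)\<close> of the two products are the squared norms of the first row
    and of the first column.\<close>
  have "(\<Sum>k<Suc n. T $$ (0, k) * cnj (T $$ (0, k))) = (\<Sum>k<Suc n. cnj (T $$ (k, 0)) * T $$ (k, 0))"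
    using arg_cong[OF Tnormal, of "\<lambda>X. X $$ (0, 0)"] T T'
    by (simp add: scalar_prod_def mat_adjoint_index[OF T] atLeast0LessThan del: sum.lessThan_Suc)
  then have "(\<Sum>k<n. T $$ (0, Suc k) * cnj (T $$ (0, Suc k))) = 0"
    by (simp add: sum.lessThan_Suc_shift col0 del: sum.lessThan_Suc)
  then have "of_real (\<Sum>k<n. (cmod (T $$ (0, Suc k)))\<^sup>2) = (0 :: complex)"
    by (simp only: of_real_sum complex_norm_square)
  then have "(\<Sum>k<n. (cmod (T $$ (0, Suc k)))\<^sup>2) = 0"
    by (simp only: of_real_eq_0_iff)
  then have row0: "T $$ (0, Suc k) = 0" if "k < n" for k
    using that by (subst (asm) sum_nonneg_eq_0_iff) auto
  define M where "M = mat n n (\<lambda>(i, j). T $$ (Suc i, Suc j))"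
  have M: "M \<in> carrier_mat n n" by (simp add: M_def)
  have TM: "T = corner_ext \<mu> M"
    using T row0 col0 by (intro corner_ext_eqI[OF M]) (simp_all add: M_def)
  have "M * mat_adjoint M = mat_adjoint M * M"
    by (rule corner_ext_inject[of _ n _ "\<mu> * cnj \<mu>" "cnj \<mu> * \<mu>"])
      (use M mat_adjoint_carrier[OF M] Tnormal in \<open>auto simp: TM corner_ext_adjoint corner_ext_mult\<close>)
  then obtain V a where V: "unitary_mat n V" "M = unitary_conj V (mat_diag n a)"
    using Suc.IH[OF M] by blast
  note VD = unitary_matD[OF V(1)] and EV = unitary_corner_ext[OF V(1)]
  have "T = unitary_conj (corner_ext 1 V) (mat_diag (Suc n) (case_nat \<mu> a))"
    using VD mult_carrier_mat[OF VD(1) mat_diag_dim, of a]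
    by (simp add: TM V(2) unitary_conj_def corner_ext_adjoint corner_ext_mult[of _ n] flip: corner_ext_diag)
  then have "N = unitary_conj (U * corner_ext 1 V) (mat_diag (Suc n) (case_nat \<mu> a))"
    by (simp add: NT unitary_conj_comp[OF U(1) EV])
  then show ?case using unitary_mat_mult[OF U(1) EV] by blast
qed

section \<open>Masas are unitarily diagonal\<close>

lemma conjugated_diagonal_algebra:
  assumes "unitary_mat n U"
  defines "E \<equiv> range (\<lambda>a. unitary_conj U (mat_diag n a))"
  shows "abelian_selfadjoint_subalgebra n E"
  unfolding abelian_selfadjoint_subalgebra_def matrix_subalgebra_def
proof (intro conjI ballI allI)
  show "E \<subseteq> carrier_mat n n"
    using unitary_conj_carrier[OF assms(1) mat_diag_dim] by (auto simp: E_def)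
  have "unitary_conj U (mat_diag n (\<lambda>_. 0)) = 0\<^sub>m n n"
  proof -
    have "mat_diag n (\<lambda>_. 0) = 0 \<cdot>\<^sub>m mat_diag n (\<lambda>_. 0 :: complex)" by (simp add: mat_diag_smult)
    then have "unitary_conj U (mat_diag n (\<lambda>_. 0)) = 0 \<cdot>\<^sub>m unitary_conj U (mat_diag n (\<lambda>_. 0))"
      using unitary_conj_smult[OF assms(1) mat_diag_dim] by metis
    also have "\<dots> = 0\<^sub>m n n"
      using carrier_matD[OF unitary_conj_carrier[OF assms(1) mat_diag_dim]] by (intro eq_matI) auto
    finally show ?thesis .
  qed
  then show "0\<^sub>m n n \<in> E" unfolding E_def by (metis rangeI)
next
  fix x y assume "x \<in> E" "y \<in> E"
  then obtain a b where *: "x = unitary_conj U (mat_diag n a)" "y = unitary_conj U (mat_diag n b)"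
    by (auto simp: E_def)
  show "x + y \<in> E" "x * y \<in> E" "x * y = y * x"
    unfolding * E_def
    by (simp_all add: mat_diag_add mult.commute flip: unitary_conj_add[OF assms(1) mat_diag_dim mat_diag_dim]
        unitary_conj_mult[OF assms(1) mat_diag_dim mat_diag_dim])
next
  fix x assume "x \<in> E"
  then obtain a where *: "x = unitary_conj U (mat_diag n a)" by (auto simp: E_def)
  show "c \<cdot>\<^sub>m x \<in> E" for c
    unfolding * E_def by (simp add: mat_diag_smult flip: unitary_conj_smult[OF assms(1) mat_diag_dim])
  show "mat_adjoint x \<in> E"
    unfolding * E_def by (simp add: unitary_conj_adjoint[OF assms(1) mat_diag_dim] mat_adjoint_diag)
qed

text \<open>Two distinct points of \<open>S\<close> collide for at most one value of \<open>\<epsilon>\<close>, so all but finitely many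
  values work. The parameter has to be real so that a combination \<open>h + \<epsilon> y\<close> of Hermitian matrices is
  again Hermitian.\<close>

lemma real_combination_inj_on:
  assumes "finite S"
  shows "\<exists>\<epsilon>::real. inj_on (\<lambda>z. Re z + \<epsilon> * Im z) S"
proof -
  have "infinite (UNIV :: real set)" by (rule infinite_UNIV_char_0)
  moreover have "finite ((\<lambda>(z, w). (Re w - Re z) / (Im z - Im w)) ` (S \<times> S))"
    using assms by simp
  ultimately obtain \<epsilon> where \<epsilon>: "\<epsilon> \<notin> (\<lambda>(z, w). (Re w - Re z) / (Im z - Im w)) ` (S \<times> S)"
    using ex_new_if_finite by blast
  have "z = w" if "z \<in> S" "w \<in> S" "Re z + \<epsilon> * Im z = Re w + \<epsilon> * Im w" for z w
  proof (cases "Im z = Im w")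
    case True
    with that(3) show ?thesis by (simp add: complex_eq_iff)
  next
    case False
    with that(3) have "\<epsilon> = (Re w - Re z) / (Im z - Im w)" by (simp add: field_simps)
    with \<epsilon> that(1,2) show ?thesis by force
  qed
  then show ?thesis by (auto simp: inj_on_def)
qed

text \<open>A matrix that intertwines two diagonal matrices maps eigenspaces to eigenspaces, hence links
  only positions that carry the same eigenvalue.\<close>

lemma intertwiner_support:
  fixes W :: "complex mat"
  assumes "W \<in> carrier_mat n n" "W * mat_diag n a = mat_diag n b * W"
    and "i < n" "j < n" "W $$ (i, j) \<noteq> 0"
  shows "a j = b i"
  using arg_cong[OF assms(2), of "\<lambda>X. X $$ (i, j)"] assms(3-5)
  by (simp add: mat_diag_mult_left[OF assms(1)] mat_diag_mult_right[OF assms(1)])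

lemma unitary_column_nonzero:
  assumes "unitary_mat n W" "j < n"
  shows "\<exists>i<n. W $$ (i, j) \<noteq> 0"
proof (rule ccontr)
  assume "\<not> ?thesis"
  then have "(mat_adjoint W * W) $$ (j, j) = 0"
    using unitary_matD(1,2)[OF assms(1)] assms(2) by (simp add: scalar_prod_def)
  then show False using assms(2) by (simp add: unitary_matD(3)[OF assms(1)])
qed

text \<open>The unitary is one that diagonalises a Hermitian element with the greatest number of distinct
  eigenvalues; such an element separates all the joint eigenspaces of the masa.\<close>

theorem masa_is_unitarily_diagonal:
  assumes "masa n D"
  obtains U where "unitary_mat n U" "D = range (\<lambda>a. unitary_conj U (mat_diag n a))"
proof -
  have sub: "D \<subseteq> carrier_mat n n" and z: "0\<^sub>m n n \<in> D"
    and ad: "\<And>x y. x \<in> D \<Longrightarrow> y \<in> D \<Longrightarrow> x + y \<in> D"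
    and sm: "\<And>c x. x \<in> D \<Longrightarrow> c \<cdot>\<^sub>m x \<in> D"
    and co: "\<And>x y. x \<in> D \<Longrightarrow> y \<in> D \<Longrightarrow> x * y = y * x"
    and sa: "\<And>x. x \<in> D \<Longrightarrow> mat_adjoint x \<in> D"
    and mx: "\<And>E. abelian_selfadjoint_subalgebra n E \<Longrightarrow> D \<subseteq> E \<Longrightarrow> E = D"
    using assms unfolding masa_def abelian_selfadjoint_subalgebra_def matrix_subalgebra_def
    by blast+
  define P where "P = (\<lambda>(U, r :: nat \<Rightarrow> real). unitary_mat n U \<and> unitary_conj U (mat_diag n (\<lambda>i. complex_of_real (r i))) \<in> D)"
  define num where "num = (\<lambda>(U :: complex mat, r :: nat \<Rightarrow> real). card (r ` {..<n}))"
  have "\<exists>p. P p"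
  proof -
    have "0\<^sub>m n n * mat_adjoint (0\<^sub>m n n) = mat_adjoint (0\<^sub>m n n) * (0\<^sub>m n n :: complex mat)"
      using z by (intro co sa)
    then obtain U a where U: "unitary_mat n U" "0\<^sub>m n n = unitary_conj U (mat_diag n a)"
      using spectral_theorem_normal[of "0\<^sub>m n n" n] by auto
    have "unitary_conj U (mat_diag n (\<lambda>i. complex_of_real 0)) = 0 \<cdot>\<^sub>m 0\<^sub>m n n"
      unfolding U(2) by (simp add: mat_diag_smult flip: unitary_conj_smult[OF U(1) mat_diag_dim])
    with sm[OF z] have "unitary_conj U (mat_diag n (\<lambda>i. complex_of_real 0)) \<in> D" by metis
    with U(1) have "P (U, \<lambda>_. 0)" by (simp add: P_def)
    then show ?thesis ..
  qed
  then obtain p0 where "P p0" ..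
  moreover have "num p < Suc n" for p
    using card_image_le[of "{..<n}" "snd p"] by (auto simp: num_def split: prod.split)
  ultimately obtain p where "P p" "\<And>q. P q \<Longrightarrow> num q \<le> num p"
    using ex_has_greatest_nat[of P p0 num "Suc n"] by (auto simp: less_imp_le)
  then obtain U r where U: "unitary_mat n U"
    and h: "unitary_conj U (mat_diag n (\<lambda>i. complex_of_real (r i))) \<in> D"
    and greatest: "\<And>V s. unitary_mat n V \<Longrightarrow> unitary_conj V (mat_diag n (\<lambda>i. complex_of_real (s i))) \<in> D
        \<Longrightarrow> card (s ` {..<n}) \<le> card (r ` {..<n})"
    by (cases p) (auto simp: P_def num_def)
  define h where "h = unitary_conj U (mat_diag n (\<lambda>i. complex_of_real (r i)))"
  have hD: "h \<in> D" and hc: "h \<in> carrier_mat n n" using h sub by (auto simp: h_def)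
  have hh: "mat_adjoint h = h"
    by (simp add: h_def unitary_conj_adjoint[OF U mat_diag_dim] mat_adjoint_diag)
  define E where "E = range (\<lambda>a. unitary_conj U (mat_diag n a))"
  have E: "abelian_selfadjoint_subalgebra n E"
    unfolding E_def by (rule conjugated_diagonal_algebra[OF U])
  have herm: "y \<in> E" if yD: "y \<in> D" and yh: "mat_adjoint y = y" for y
  proof -
    have yc: "y \<in> carrier_mat n n" using yD sub by blast
    \<comment> \<open>One unitary diagonalises \<open>h\<close> and \<open>y\<close>, which are the real and imaginary parts of \<open>N\<close>.\<close>
    define N where "N = h + \<i> \<cdot>\<^sub>m y"
    have ND: "N \<in> D" unfolding N_def using hD yD by (intro ad sm)
    then have Nc: "N \<in> carrier_mat n n" using sub by blast
    have Nadj: "mat_adjoint N = h + (- \<i>) \<cdot>\<^sub>m y"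
      using hc yc by (simp add: N_def mat_adjoint_add[of _ n] mat_adjoint_smult[of _ n] hh yh)
    obtain V c where V: "unitary_mat n V" and N: "N = unitary_conj V (mat_diag n c)"
      using spectral_theorem_normal[OF Nc co[OF ND sa[OF ND]]] by blast
    have Nadj': "mat_adjoint N = unitary_conj V (mat_diag n (\<lambda>i. cnj (c i)))"
      by (simp add: N unitary_conj_adjoint[OF V mat_diag_dim] mat_adjoint_diag)
    have "h = (1 / 2) \<cdot>\<^sub>m (N + mat_adjoint N)"
      unfolding Nadj unfolding N_def using hc yc by (intro eq_matI) auto
    also have "\<dots> = unitary_conj V (mat_diag n (\<lambda>i. (1 / 2) * (c i + cnj (c i))))"
      unfolding Nadj' unfolding N
      by (simp add: mat_diag_add mat_diag_smult flip: unitary_conj_add[OF V mat_diag_dim mat_diag_dim] unitary_conj_smult[OF V mat_diag_dim])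
    also have "(\<lambda>i. (1 / 2) * (c i + cnj (c i))) = (\<lambda>i. complex_of_real (Re (c i)))"
      by (simp add: complex_add_cnj)
    finally have hV: "h = unitary_conj V (mat_diag n (\<lambda>i. complex_of_real (Re (c i))))" .
    have "y = (- \<i> / 2) \<cdot>\<^sub>m (N + (- 1) \<cdot>\<^sub>m mat_adjoint N)"
      unfolding Nadj unfolding N_def using hc yc by (intro eq_matI) (auto simp: algebra_simps)
    also have "\<dots> = unitary_conj V (mat_diag n (\<lambda>i. (- \<i> / 2) * (c i + (- 1) * cnj (c i))))"
      unfolding Nadj' unfolding N
      by (simp only: mat_diag_add mat_diag_smult flip: unitary_conj_add[OF V mat_diag_dim mat_diag_dim] unitary_conj_smult[OF V mat_diag_dim])
    also have "(\<lambda>i. (- \<i> / 2) * (c i + (- 1) * cnj (c i))) = (\<lambda>i. complex_of_real (Im (c i)))"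
      by (auto simp: complex_eq_iff)
    finally have yV: "y = unitary_conj V (mat_diag n (\<lambda>i. complex_of_real (Im (c i))))" .
    note UD = unitary_matD[OF U] and VD = unitary_matD[OF V]
    \<comment> \<open>The change of basis between the two diagonalisations of \<open>h\<close>.\<close>
    define W where "W = mat_adjoint V * U"
    have W: "unitary_mat n W"
      unfolding W_def by (intro unitary_mat_mult unitary_mat_adjoint U V)
    note WD = unitary_matD[OF W]
    have "W * mat_diag n (\<lambda>i. complex_of_real (r i)) = mat_adjoint V * h * U"
      using UD unitary_cancel[OF U] VD(1,2)
      by (simp add: W_def h_def unitary_conj_def square_mat[where n=n] right_mult_one_mat[of _ n n])
    also have "\<dots> = mat_diag n (\<lambda>i. complex_of_real (Re (c i))) * W"
      using VD unitary_cancel[OF V] UD(1,2)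
      by (simp add: W_def hV unitary_conj_def square_mat[where n=n])
    finally have intertwine: "W * mat_diag n (\<lambda>i. complex_of_real (r i))
        = mat_diag n (\<lambda>i. complex_of_real (Re (c i))) * W" .
    have r: "r j = Re (c i)" if "i < n" "j < n" "W $$ (i, j) \<noteq> 0" for i j
      using intertwiner_support[OF WD(1) intertwine that] by simp
    \<comment> \<open>The three cardinality bounds close a cycle, so they are equalities, and \<open>Re\<close> is
      injective on the eigenvalues of \<open>N\<close>: the eigenvalue of \<open>h\<close> determines that of \<open>y\<close>.\<close>
    have "r ` {..<n} \<subseteq> Re ` c ` {..<n}"
      using unitary_column_nonzero[OF W] r by fastforce
    then have "card (r ` {..<n}) \<le> card (Re ` c ` {..<n})"
      by (intro card_mono) auto
    moreover have "card (c ` {..<n}) \<le> card (r ` {..<n})"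
    proof -
      obtain \<epsilon> where inj: "inj_on (\<lambda>z. Re z + \<epsilon> * Im z) (c ` {..<n})"
        using real_combination_inj_on[of "c ` {..<n}"] by auto
      have "h + complex_of_real \<epsilon> \<cdot>\<^sub>m y = unitary_conj V (mat_diag n (\<lambda>i. complex_of_real (Re (c i) + \<epsilon> * Im (c i))))"
        unfolding hV yV
        by (simp add: mat_diag_add mat_diag_smult flip: unitary_conj_add[OF V mat_diag_dim mat_diag_dim] unitary_conj_smult[OF V mat_diag_dim])
      with ad[OF hD sm[OF yD]] have "unitary_conj V (mat_diag n (\<lambda>i. complex_of_real (Re (c i) + \<epsilon> * Im (c i)))) \<in> D"
        by metis
      from greatest[OF V this] have "card ((\<lambda>z. Re z + \<epsilon> * Im z) ` c ` {..<n}) \<le> card (r ` {..<n})"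
        by (simp add: image_image)
      with card_image[OF inj] show ?thesis by simp
    qed
    moreover have "card (Re ` c ` {..<n}) \<le> card (c ` {..<n})"
      by (intro card_image_le) auto
    ultimately have "inj_on Re (c ` {..<n})"
      by (intro eq_card_imp_inj_on) auto
    then have fn: "Im (c i) = Im (c k)" if "i < n" "k < n" "Re (c i) = Re (c k)" for i k
      using that by (metis imageI inj_onD lessThan_iff)
    \<comment> \<open>The eigenvalue of \<open>y\<close> that belongs to the eigenvalue \<open>r j\<close> of \<open>h\<close>.\<close>
    define e where "e j = complex_of_real (Im (c (SOME i. i < n \<and> Re (c i) = r j)))" for j
    have e: "e j = complex_of_real (Im (c i))" if "i < n" "j < n" "W $$ (i, j) \<noteq> 0" for i j
    proof -
      have "i < n \<and> Re (c i) = r j" using r[OF that] that by simp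
      then have "\<exists>k. k < n \<and> Re (c k) = r j" by blast
      from someI_ex[OF this] have "\<exists>k. k < n \<and> Re (c k) = r j \<and> e j = complex_of_real (Im (c k))"
        unfolding e_def by blast
      then show ?thesis using fn[OF _ that(1)] r[OF that] by fastforce
    qed
    have "W * mat_diag n e = mat_diag n (\<lambda>i. complex_of_real (Im (c i))) * W"
      unfolding mat_diag_mult_left[OF WD(1)] mat_diag_mult_right[OF WD(1)]
      using e by (intro eq_matI) (auto simp: mult.commute)
    then have "W * mat_diag n e * mat_adjoint W = mat_diag n (\<lambda>i. complex_of_real (Im (c i))) * (W * mat_adjoint W)"
      by (simp add: assoc_mult_mat[OF mat_diag_dim WD(1,2)])
    then have "W * mat_diag n e * mat_adjoint W = mat_diag n (\<lambda>i. complex_of_real (Im (c i)))"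
      by (simp add: WD right_mult_one_mat[OF mat_diag_dim])
    moreover have "V * W = U" unfolding W_def by (rule unitary_cancel(2)[OF V UD(1)])
    ultimately have "y = unitary_conj U (mat_diag n e)"
      using unitary_conj_comp[OF V W mat_diag_dim, of e] by (simp add: yV unitary_conj_def[of W])
    then show ?thesis by (auto simp: E_def)
  qed
  have "D \<subseteq> E"
  proof
    fix x assume x: "x \<in> D"
    then have xc: "x \<in> carrier_mat n n" using sub by blast
    note xa = mat_adjoint_carrier[OF xc]
    \<comment> \<open>Twice the Hermitian part of \<open>x\<close>, and \<open>\<i>\<close> times twice its skew-Hermitian part; the factor \<open>\<i>\<close> makes
      \<open>z\<close> Hermitian.\<close>
    define y z where "y = x + mat_adjoint x" and "z = \<i> \<cdot>\<^sub>m (x + (- 1) \<cdot>\<^sub>m mat_adjoint x)"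
    have "y \<in> E"
      unfolding y_def by (rule herm)
        (use x xc xa in \<open>simp_all add: ad sa mat_adjoint_add[of _ n] square_mat[where n=n] comm_add_mat[of _ n n]\<close>)
    moreover have "z \<in> E"
    proof (rule herm)
      show "z \<in> D" unfolding z_def using x by (intro ad sm sa)
      show "mat_adjoint z = z"
      proof -
        have "mat_adjoint z = (- \<i>) \<cdot>\<^sub>m (mat_adjoint x + (- 1) \<cdot>\<^sub>m x)"
          unfolding z_def using xc xa
          by (simp add: mat_adjoint_add[of _ n] mat_adjoint_smult[of _ n] square_mat[where n=n])
        also have "\<dots> = z"
          unfolding z_def using carrier_matD[OF xc] carrier_matD[OF xa]
          by (intro eq_matI) (simp_all add: algebra_simps)
        finally show ?thesis .
      qed
    qed
    moreover have "x = (1 / 2) \<cdot>\<^sub>m (y + (- \<i>) \<cdot>\<^sub>m z)"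
      unfolding y_def z_def using xc carrier_matD[OF xa] by (intro eq_matI) (auto simp: algebra_simps)
    ultimately show "x \<in> E"
      using E unfolding abelian_selfadjoint_subalgebra_def matrix_subalgebra_def by metis
  qed
  then have "E = D" by (rule mx[OF E])
  then show ?thesis using U that unfolding E_def by blast
qed

section \<open>Ideals and their patterns\<close>

text \<open>If \<open>x \<in> J\<close> is nonzero at \<open>(i, j)\<close>, cutting \<open>x\<close> down by diagonal matrix units on both sides leaves
  a multiple of the matrix unit at \<open>(i, j)\<close>. So \<open>M\<close> can be assembled inside \<open>J\<close> one entry at a time.\<close>

lemma diagonal_bimodule_pattern:
  fixes J :: "complex mat set"
  assumes sub: "J \<subseteq> carrier_mat n n" and zero: "0\<^sub>m n n \<in> J"
    and add: "\<And>x y. x \<in> J \<Longrightarrow> y \<in> J \<Longrightarrow> x + y \<in> J"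
    and left: "\<And>f x. x \<in> J \<Longrightarrow> mat_diag n f * x \<in> J"
    and right: "\<And>f x. x \<in> J \<Longrightarrow> x * mat_diag n f \<in> J"
    and M: "M \<in> carrier_mat n n"
    and pattern: "\<And>i j. i < n \<Longrightarrow> j < n \<Longrightarrow> M $$ (i, j) \<noteq> 0 \<Longrightarrow> \<exists>x\<in>J. x $$ (i, j) \<noteq> 0"
  shows "M \<in> J"
proof -
  define R where "R F = mat n n (\<lambda>p. if p \<in> F then M $$ p else 0)" for F
  have "R F \<in> J" if "finite F" "F \<subseteq> {..<n} \<times> {..<n}" for F
    using that
  proof (induction F rule: finite_induct)
    case empty
    have "R {} = 0\<^sub>m n n" by (intro eq_matI) (auto simp: R_def)
    then show ?case using zero by simp
  next
    case (insert p F)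
    obtain i j where p: "p = (i, j)" "i < n" "j < n" using insert.prems by (cases p) auto
    have RF: "R F \<in> J" using insert by simp
    show ?case
    proof (cases "M $$ (i, j) = 0")
      case True
      then have "R (insert p F) = R F" by (intro eq_matI) (auto simp: R_def p)
      then show ?thesis using RF by simp
    next
      case False
      then obtain x where x: "x \<in> J" "x $$ (i, j) \<noteq> 0" using pattern p by blast
      then have xc: "x \<in> carrier_mat n n" using sub by blast
      define f where "f k = (if k = i then M $$ (i, j) / x $$ (i, j) else 0)" for k
      define g where "g k = (if k = j then 1 else 0 :: complex)" for k
      have "mat_diag n f * x * mat_diag n g = mat n n (\<lambda>(k, l). f k * x $$ (k, l) * g l)"
        unfolding mat_diag_mult_left[OF xc]
        by (subst mat_diag_mult_right[of _ n n]) (auto intro!: eq_matI)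
      then have "R (insert p F) = mat_diag n f * x * mat_diag n g + R F"
        using insert.hyps(2) x(2) by (intro eq_matI) (auto simp: R_def p f_def g_def)
      then show ?thesis using add[OF right[OF left[OF x(1)]] RF] by metis
    qed
  qed
  then have "R ({..<n} \<times> {..<n}) \<in> J" by simp
  moreover have "R ({..<n} \<times> {..<n}) = M"
    using M by (intro eq_matI) (auto simp: R_def)
  ultimately show ?thesis by simp
qed

text \<open>In the basis in which \<open>A\<close> contains the diagonal matrices, an ideal of \<open>A\<close> is a bimodule over
  them, so \<open>diagonal_bimodule_pattern\<close> applies.\<close>

lemma ideal_determined_by_pattern:
  assumes K: "ideal K (subalgebra_ring n A)" and A: "digraph_algebra n A"
    and U: "unitary_mat n U" and diag: "\<And>f. unitary_conj U (mat_diag n f) \<in> A"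
    and x: "x \<in> carrier_mat n n"
    and pattern: "\<And>i j. i < n \<Longrightarrow> j < n \<Longrightarrow> unitary_conj (mat_adjoint U) x $$ (i, j) \<noteq> 0
      \<Longrightarrow> \<exists>y\<in>K. unitary_conj (mat_adjoint U) y $$ (i, j) \<noteq> 0"
  shows "x \<in> K"
proof -
  interpret ideal K "subalgebra_ring n A" by (rule K)
  let ?\<phi> = "unitary_conj (mat_adjoint U)"
  note U' = unitary_mat_adjoint[OF U]
  have KA: "K \<subseteq> A" using a_subset by (simp add: subalgebra_ring_def)
  then have Kc: "y \<in> carrier_mat n n" if "y \<in> K" for y
    using A that unfolding digraph_algebra_def matrix_subalgebra_def by blast
  have add: "y + z \<in> K" if "y \<in> K" "z \<in> K" for y z
    using additive_subgroup.a_closed[OF is_additive_subgroup that]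
    by (simp add: subalgebra_ring_def ring_mat_def)
  have zero: "0\<^sub>m n n \<in> K"
    using additive_subgroup.zero_closed[OF is_additive_subgroup]
    by (simp add: subalgebra_ring_def ring_mat_def)
  have left: "a * y \<in> K" and right: "y * a \<in> K" if "y \<in> K" "a \<in> A" for y a
    using I_l_closed[of y a] I_r_closed[of y a] that
    by (simp_all add: subalgebra_ring_def ring_mat_def)
  have \<phi>diag: "mat_diag n f = ?\<phi> (unitary_conj U (mat_diag n f))" for f
    by (simp add: unitary_conj_inverse[OF U mat_diag_dim])
  note dc = unitary_conj_carrier[OF U mat_diag_dim]
  have "?\<phi> x \<in> ?\<phi> ` K"
  proof (rule diagonal_bimodule_pattern)
    show "?\<phi> ` K \<subseteq> carrier_mat n n" using unitary_conj_carrier[OF U' Kc] by blast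
    have "?\<phi> (0\<^sub>m n n) = 0\<^sub>m n n"
      using unitary_matD(1,2)[OF U'] by (simp add: unitary_conj_def)
    then show "0\<^sub>m n n \<in> ?\<phi> ` K" using zero by (metis image_eqI)
    show "?\<phi> x \<in> carrier_mat n n" by (rule unitary_conj_carrier[OF U' x])
    show "\<exists>z\<in>?\<phi> ` K. z $$ (i, j) \<noteq> 0" if "i < n" "j < n" "?\<phi> x $$ (i, j) \<noteq> 0" for i j
      using pattern[OF that] by blast
  next
    fix y z assume "y \<in> ?\<phi> ` K" "z \<in> ?\<phi> ` K"
    then obtain y' z' where *: "y' \<in> K" "z' \<in> K" "y = ?\<phi> y'" "z = ?\<phi> z'" by blast
    then show "y + z \<in> ?\<phi> ` K"
      using add[OF *(1,2)] unitary_conj_add[OF U' Kc[OF *(1)] Kc[OF *(2)]] by (metis image_eqI)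
  next
    fix f y assume "y \<in> ?\<phi> ` K"
    then obtain y' where *: "y' \<in> K" "y = ?\<phi> y'" by blast
    show "mat_diag n f * y \<in> ?\<phi> ` K"
      using left[OF *(1) diag] unitary_conj_mult[OF U' dc Kc[OF *(1)]] \<phi>diag *(2) by (metis image_eqI)
    show "y * mat_diag n f \<in> ?\<phi> ` K"
      using right[OF *(1) diag] unitary_conj_mult[OF U' Kc[OF *(1)] dc] \<phi>diag *(2) by (metis image_eqI)
  qed
  then obtain y where y: "?\<phi> x = ?\<phi> y" "y \<in> K" by (rule imageE)
  then have "x = y"
    using unitary_conj_inverse(2)[OF U x] unitary_conj_inverse(2)[OF U Kc[OF y(2)]] by metis
  with y(2) show ?thesis by simp
qed

theorem theorem4p2p2:
  fixes n :: nat and A I :: "complex mat set"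
  assumes "digraph_algebra n A"
    and "ideal I (subalgebra_ring n A)"
  shows "principalideal I (subalgebra_ring n A)"
proof (rule principalidealI[OF assms(2)])
  let ?R = "subalgebra_ring n A"
  have R: "ring ?R" by (rule ring_digraph_algebra[OF assms(1)])
  obtain D where D: "masa n D" "D \<subseteq> A" using assms(1) unfolding digraph_algebra_def by blast
  obtain U where U: "unitary_mat n U" and DU: "D = range (\<lambda>a. unitary_conj U (mat_diag n a))"
    by (rule masa_is_unitarily_diagonal[OF D(1)])
  have diag: "unitary_conj U (mat_diag n f) \<in> A" for f using D(2) DU by blast
  let ?\<phi> = "unitary_conj (mat_adjoint U)"
  \<comment> \<open>The 0-1 matrix of the pattern of \<open>I\<close>; transported back to \<open>A\<close>, it is the generator.\<close>
  define G where "G = mat n n (\<lambda>(i, j). if \<exists>x\<in>I. ?\<phi> x $$ (i, j) \<noteq> 0 then 1 else 0 :: complex)"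
  define g where "g = unitary_conj U G"
  have G: "G \<in> carrier_mat n n" by (simp add: G_def)
  then have \<phi>g: "?\<phi> g = G" by (simp add: g_def unitary_conj_inverse[OF U])
  have gc: "g \<in> carrier_mat n n" unfolding g_def by (rule unitary_conj_carrier[OF U G])
  have gI: "g \<in> I"
    by (rule ideal_determined_by_pattern[OF assms(2,1) U diag gc])
      (auto simp: \<phi>g G_def split: if_splits)
  have IA: "I \<subseteq> carrier ?R"
    using additive_subgroup.a_subset[OF ideal.axioms(1)[OF assms(2)]] .
  then have gR: "g \<in> carrier ?R" using gI by blast
  then have K: "ideal (Idl\<^bsub>?R\<^esub> {g}) ?R" and gK: "g \<in> Idl\<^bsub>?R\<^esub> {g}"
    using ring.genideal_ideal[OF R, of "{g}"] ring.genideal_self'[OF R, of g] by auto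
  have "I \<subseteq> Idl\<^bsub>?R\<^esub> {g}"
  proof
    fix x assume x: "x \<in> I"
    then have "x \<in> carrier_mat n n"
      using IA assms(1) by (auto simp: subalgebra_ring_def digraph_algebra_def matrix_subalgebra_def)
    then show "x \<in> Idl\<^bsub>?R\<^esub> {g}"
    proof (rule ideal_determined_by_pattern[OF K assms(1) U diag])
      fix i j assume "i < n" "j < n" "?\<phi> x $$ (i, j) \<noteq> 0"
      then have "?\<phi> g $$ (i, j) \<noteq> 0" using x by (auto simp: \<phi>g G_def)
      then show "\<exists>y\<in>Idl\<^bsub>?R\<^esub> {g}. ?\<phi> y $$ (i, j) \<noteq> 0" using gK by blast
    qed
  qed
  moreover have "Idl\<^bsub>?R\<^esub> {g} \<subseteq> I"
    using ring.genideal_minimal[OF R assms(2), of "{g}"] gI by simp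
  ultimately show "\<exists>i\<in>carrier ?R. I = Idl\<^bsub>?R\<^esub> {i}" using gR by blast
qed

end
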